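(* Let $d \ge 1$. Consider a discrete-time birth-and-death chain with transition kernel $P^*$ on the state space $\{0, \dots, d\}$ started at $0$. Suppose that $d$ is an absorbing state, and suppose that the other birth probabilities $p^*_i$, $0 \le i \le d-1$, and death probabilities $q^*_i$, $1 \le i \le d-1$, are (strictly) positive. Then the absorption time in state $d$ has probability generating function $$ u \mapsto \prod_{j = 0}^{d - 1} \left[ \frac{(1 - \theta_j) u}{1 - \theta_j u} \right], $$ where $-1 \le \theta_j < 1$ $(0 \le j \le d-1)$ are the $d$ non-unit eigenvalues of $P^*$.
   Context: A discrete-time birth-and-death chain on $\{0,\dots,d\}$ with death, hold and birth probabilities $q^*_i, r^*_i, p^*_i$ has tridiagonal transition matrix $P^*(i,i-1)=q^*_i$, $P^*(i,i)=r^*_i$, $P^*(i,i+1)=p^*_i$, with $q^*_i+r^*_i+p^*_i=1$, $q^*_0=0$, $p^*_d=0$. That $d$ is absorbing means $P^*(d,d)=1$. The absorption time in state $d$ is the first time the chain is in state $d$. The probability generating function of a nonnegative-integer-valued random variable $T$ is $u\mapsto \mathbf{E}\,u^{T}$. Eigenvalues are counted with multiplicity. *)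

theory Defs
  imports "HOL-Probability.Probability" "Jordan_Normal_Form.Char_Poly"
begin

hide_const (open) Finite_Cartesian_Product.mat

definition bd_probs :: "nat \<Rightarrow> (nat \<Rightarrow> real) \<Rightarrow> (nat \<Rightarrow> real) \<Rightarrow> (nat \<Rightarrow> real) \<Rightarrow> bool" where
  "bd_probs d q r p \<longleftrightarrow>
     (\<forall>i\<le>d. 0 \<le> q i \<and> 0 \<le> r i \<and> 0 \<le> p i \<and> q i + r i + p i = 1) \<and> q 0 = 0 \<and> p d = 0"

definition bd_kernel :: "nat \<Rightarrow> (nat \<Rightarrow> real) \<Rightarrow> (nat \<Rightarrow> real) \<Rightarrow> (nat \<Rightarrow> real) \<Rightarrow> real mat" where
  "bd_kernel d q r p = mat (d + 1) (d + 1) (\<lambda>(i, j).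
     if i = j + 1 then q i else if i = j then r i else if j = i + 1 then p i else 0)"

definition markov_chain :: "'w measure \<Rightarrow> nat set \<Rightarrow> real mat \<Rightarrow> (nat \<Rightarrow> 'w \<Rightarrow> nat) \<Rightarrow> bool" where
  "markov_chain M S P X \<longleftrightarrow>
     (\<forall>n. X n \<in> measurable M (count_space S)) \<and>
     (\<forall>n x. \<forall>j\<in>S. (\<forall>k\<le>n. x k \<in> S) \<longrightarrow>
        \<P>(\<omega> in M. \<forall>k\<le>n. X k \<omega> = x k) > 0 \<longrightarrow>
        \<P>(\<omega> in M. X (Suc n) \<omega> = j \<bar> (\<forall>k\<le>n. X k \<omega> = x k)) = P $$ (x n, j))"

text \<open>The infimum of the empty set is \<open>\<infinity>\<close>, the value on paths that never visit \<open>s\<close>.\<close>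

definition hitting_time :: "(nat \<Rightarrow> 'w \<Rightarrow> nat) \<Rightarrow> nat \<Rightarrow> 'w \<Rightarrow> enat" where
  "hitting_time X s \<omega> = (INF n\<in>{n. X n \<omega> = s}. enat n)"

text \<open>The event \<open>T = \<infinity>\<close> contributes \<open>0\<close>, so the value at \<open>u = 1\<close> is the probability
  that \<open>T\<close> is finite.\<close>

definition pgf :: "'w measure \<Rightarrow> ('w \<Rightarrow> enat) \<Rightarrow> complex \<Rightarrow> complex" where
  "pgf M T u = (\<integral>\<omega>. (case T \<omega> of enat n \<Rightarrow> u ^ n | \<infinity> \<Rightarrow> 0) \<partial>M)"

text \<open>Complex eigenvalues of a real matrix, with algebraic multiplicity.\<close>

definition eigenvalues_mset :: "real mat \<Rightarrow> complex multiset" where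
  "eigenvalues_mset A = proots (char_poly (map_mat complex_of_real A))"

end

theory Submission
  imports Defs
begin

text \<open>
  Let \<open>D\<^sub>k\<close> be the characteristic polynomial of the kernel restricted to \<open>{0..<k}\<close>. Since \<open>d\<close> is
  absorbing, the characteristic polynomial of the kernel is \<open>(x - 1) D\<^sub>d(x)\<close>. By the three-term
  recurrence of the \<open>D\<^sub>k\<close>, the function \<open>\<phi>(k) = D\<^sub>k(x) / (p\<^sub>0 \<cdots> p\<^sub>k\<^sub>-\<^sub>1)\<close> satisfies the eigenvalue
  equation \<open>P \<phi> = x \<phi>\<close> at all states below \<open>d\<close>, and \<open>\<phi>(0) = 1\<close>. Hence, with \<open>u = 1 / x\<close> and \<open>T\<close> the
  absorption time, stopping the martingale \<open>u\<^sup>n \<phi>(X\<^sub>n)\<close> at \<open>T\<close> gives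
  \<open>E u\<^sup>T = 1 / \<phi>(d) = p\<^sub>0 \<cdots> p\<^sub>d\<^sub>-\<^sub>1 / D\<^sub>d(1/u)\<close>, where \<open>p\<^sub>0 \<cdots> p\<^sub>d\<^sub>-\<^sub>1 = D\<^sub>d(1)\<close>. The stopping is justified up to
  \<open>|u| = 1\<close> because the probability of not being absorbed by time \<open>n\<close> tends to \<open>0\<close>. The same fact
  bounds the roots \<open>\<theta>\<close> of \<open>D\<^sub>d\<close>: there \<open>\<phi>(d) = 0\<close>, so the mean of \<open>\<phi>(X\<^sub>n)\<close> is \<open>\<theta>\<^sup>n\<close> and tends to \<open>0\<close>.
\<close>

section \<open>Determinants of tridiagonal matrices\<close>

definition tridiag_mat :: "nat \<Rightarrow> (nat \<Rightarrow> 'a) \<Rightarrow> (nat \<Rightarrow> 'a) \<Rightarrow> (nat \<Rightarrow> 'a) \<Rightarrow> 'a::zero mat" where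
  "tridiag_mat n a b c = mat n n (\<lambda>(i, j).
     if i = j + 1 then a i else if i = j then b i else if j = i + 1 then c i else 0)"

lemma tridiag_mat_carrier [simp]: "tridiag_mat n a b c \<in> carrier_mat n n"
  by (simp add: tridiag_mat_def)

text \<open>Laplace expansion along the last row leaves two cofactors. The off-diagonal minor has
  \<open>c n\<close> as the only nonzero entry of its last column, so a second expansion brings it
  down to the leading block of size \<open>n\<close>. Indexing all three diagonals by row makes the
  smaller matrices leading blocks.\<close>

lemma det_tridiag_mat_Suc_Suc:
  fixes a b c :: "nat \<Rightarrow> 'a::comm_ring_1"
  shows "Determinant.det (tridiag_mat (Suc (Suc n)) a b c) =
    b (Suc n) * Determinant.det (tridiag_mat (Suc n) a b c)
    - a (Suc n) * c n * Determinant.det (tridiag_mat n a b c)"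
proof -
  let ?T = "\<lambda>n. tridiag_mat n a b c"
  let ?L = "mat_delete (?T (Suc (Suc n))) (Suc n) n"
  have L: "?L \<in> carrier_mat (Suc n) (Suc n)"
    using mat_delete_carrier[OF tridiag_mat_carrier, of "Suc (Suc n)" a b c "Suc n" n] by simp
  have d1: "mat_delete (?T (Suc (Suc n))) (Suc n) (Suc n) = ?T (Suc n)"
    by (rule eq_matI) (auto simp: mat_delete_def tridiag_mat_def)
  have d2: "mat_delete ?L n n = ?T n"
    by (rule eq_matI) (auto simp: mat_delete_def tridiag_mat_def)
  have "Determinant.det ?L = (\<Sum>i<Suc n. ?L $$ (i, n) * cofactor ?L i n)"
    by (rule laplace_expansion_column[OF L]) simp
  also have "\<dots> = c n * Determinant.det (?T n)"
  proof -
    have "?L $$ (i, n) = 0" if "i < n" for i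
      using that by (simp add: mat_delete_def tridiag_mat_def)
    moreover have "?L $$ (n, n) = c n"
      by (simp add: mat_delete_def tridiag_mat_def)
    ultimately show ?thesis
      by (simp add: cofactor_def d2)
  qed
  finally have detL: "Determinant.det ?L = c n * Determinant.det (?T n)" .
  have "Determinant.det (?T (Suc (Suc n))) =
      (\<Sum>j<Suc (Suc n). ?T (Suc (Suc n)) $$ (Suc n, j) * cofactor (?T (Suc (Suc n))) (Suc n) j)"
    by (rule laplace_expansion_row[OF tridiag_mat_carrier]) simp
  also have "\<dots> = b (Suc n) * Determinant.det (?T (Suc n)) - a (Suc n) * c n * Determinant.det (?T n)"
  proof -
    have "?T (Suc (Suc n)) $$ (Suc n, j) = 0" if "j < n" for j
      using that by (simp add: tridiag_mat_def)
    moreover have "?T (Suc (Suc n)) $$ (Suc n, n) = a (Suc n)"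
      "?T (Suc (Suc n)) $$ (Suc n, Suc n) = b (Suc n)"
      by (simp_all add: tridiag_mat_def)
    ultimately show ?thesis
      by (simp add: cofactor_def d1 detL algebra_simps)
  qed
  finally show ?thesis .
qed

section \<open>Generating functions and hitting times\<close>

text \<open>Dominated convergence: the partial sums are the integrals of the integrand cut off to
  \<open>T < N\<close>, and these are bounded by 1 because \<open>norm u \<le> 1\<close>.
  Measurability of the full integrand comes from the same pointwise limit.\<close>

lemma prob_space_pgf_sums:
  fixes u :: complex
  assumes "prob_space M"
    and meas: "\<And>n. {\<omega> \<in> space M. T \<omega> = enat n} \<in> sets M"
    and u: "norm u \<le> 1"
  shows "(\<lambda>n. of_real (\<P>(\<omega> in M. T \<omega> = enat n)) * u ^ n) sums pgf M T u"
proof -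
  interpret prob_space M by fact
  let ?B = "\<lambda>n. {\<omega> \<in> space M. T \<omega> = enat n}"
  let ?f = "\<lambda>\<omega>. case T \<omega> of enat n \<Rightarrow> u ^ n | \<infinity> \<Rightarrow> 0"
  let ?s = "\<lambda>N \<omega>. \<Sum>n<N. indicator (?B n) \<omega> *\<^sub>R u ^ n"
  note [measurable] = meas
  have s: "?s N \<omega> = (case T \<omega> of enat n \<Rightarrow> if n < N then u ^ n else 0 | \<infinity> \<Rightarrow> 0)"
    if "\<omega> \<in> space M" for N \<omega>
  proof (cases "T \<omega>")
    case (enat m)
    have "?s N \<omega> = (\<Sum>n<N. if n = m then u ^ m else 0)"
      using that enat by (intro sum.cong) (auto simp: indicator_def)
    then show ?thesis
      using enat by simp
  qed (simp add: indicator_def)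
  have lim: "(\<lambda>N. ?s N \<omega>) \<longlonglongrightarrow> ?f \<omega>" if "\<omega> \<in> space M" for \<omega>
  proof (cases "T \<omega>")
    case (enat m)
    have "eventually (\<lambda>N. ?s N \<omega> = ?f \<omega>) sequentially"
      using eventually_gt_at_top[of m] by eventually_elim (unfold s[OF that], simp add: enat)
    then show ?thesis
      by (rule tendsto_eventually)
  qed (use that in \<open>simp add: s\<close>)
  have smeas: "?s N \<in> borel_measurable M" for N
    by measurable
  have fmeas: "?f \<in> borel_measurable M"
    by (rule borel_measurable_LIMSEQ_metric[OF smeas lim])
  have "(\<lambda>N. \<integral>\<omega>. ?s N \<omega> \<partial>M) \<longlonglongrightarrow> (\<integral>\<omega>. ?f \<omega> \<partial>M)"
  proof (rule integral_dominated_convergence[where w = "\<lambda>_. 1"])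
    show "AE \<omega> in M. norm (?s N \<omega>) \<le> 1" for N
    proof (rule AE_I2)
      fix \<omega> assume "\<omega> \<in> space M"
      then show "norm (?s N \<omega>) \<le> 1"
        unfolding s[OF \<open>\<omega> \<in> space M\<close>] using u by (auto simp: norm_power power_le_one split: enat.split)
    qed
  qed (use smeas fmeas lim in auto)
  moreover have "(\<integral>\<omega>. ?s N \<omega> \<partial>M) = (\<Sum>n<N. of_real (prob (?B n)) * u ^ n)" for N
    by (subst Bochner_Integration.integral_sum)
       (auto simp: scaleR_conv_of_real emeasure_eq_measure intro!: integrable_scaleR_left sum.cong)
  ultimately show ?thesis
    by (simp add: sums_def pgf_def)
qed

lemma hitting_time_eq_enat_iff:
  "hitting_time X s \<omega> = enat n \<longleftrightarrow> X n \<omega> = s \<and> (\<forall>k<n. X k \<omega> \<noteq> s)"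
proof (cases "\<exists>k. X k \<omega> = s")
  case True
  define m where "m = (LEAST k. X k \<omega> = s)"
  have m: "X m \<omega> = s" "\<And>k. X k \<omega> = s \<Longrightarrow> m \<le> k"
    unfolding m_def using True by (auto intro: LeastI Least_le)
  have "hitting_time X s \<omega> = enat m"
    unfolding hitting_time_def
    by (rule antisym) (use m in \<open>auto intro!: INF_lower INF_greatest\<close>)
  then show ?thesis
    using m by (metis enat.inject le_antisym not_le)
next
  case False
  then have "hitting_time X s \<omega> = \<infinity>"
    by (simp add: hitting_time_def top_enat_def)
  with False show ?thesis
    by auto
qed

section \<open>Markov chains on a finite state space\<close>

lemma markov_chain_in_states:
  assumes "markov_chain M S P X" "\<omega> \<in> space M"
  shows "X n \<omega> \<in> S"
  using assms measurable_space[of "X n" M "count_space S"] by (simp add: markov_chain_def)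

lemma markov_chain_events:
  assumes "markov_chain M S P X"
  shows "{\<omega> \<in> space M. X n \<omega> = i} \<in> sets M"
proof -
  have "{\<omega> \<in> space M. X n \<omega> = i} = X n -` (S \<inter> {i}) \<inter> space M"
    using markov_chain_in_states[OF assms] by auto
  also have "\<dots> \<in> sets M"
    using assms by (intro measurable_sets[of _ _ "count_space S"]) (auto simp: markov_chain_def)
  finally show ?thesis .
qed

text \<open>The Markov property conditions on whole histories, so the event is split into the
  finitely many histories that end in \<open>i\<close>. Histories of probability 0, on which nothing
  is assumed, contribute 0 to both sides.\<close>

lemma markov_chain_joint_prob:
  assumes "prob_space M" and mc: "markov_chain M S P X" and S: "finite S"
    and i: "i \<in> S" and j: "j \<in> S"
  shows "\<P>(\<omega> in M. X n \<omega> = i \<and> X (Suc n) \<omega> = j) = \<P>(\<omega> in M. X n \<omega> = i) * P $$ (i, j)"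
proof -
  interpret prob_space M by fact
  note XS = markov_chain_in_states[OF mc] and ev = markov_chain_events[OF mc]
  \<comment> \<open>\<open>PiE\<close> fixes the values beyond time \<open>n\<close>, so that
    \<open>I\<close> is finite and every outcome follows exactly one of its histories.\<close>
  define I where "I = {x \<in> PiE {..n} (\<lambda>_. S). x n = i}"
  let ?path = "\<lambda>x \<omega>. \<forall>k\<le>n. X k \<omega> = x k"
  have I: "finite I"
    unfolding I_def by (intro finite_Collect_conjI disjI1) (simp add: S finite_PiE)
  have path: "{\<omega> \<in> space M. ?path x \<omega>} \<in> sets M" for x
    by (intro sets.sets_Collect ev)
  have path2: "{\<omega> \<in> space M. ?path x \<omega> \<and> X (Suc n) \<omega> = j} \<in> sets M" for x
    by (intro sets.sets_Collect_conj path ev)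
  have ex1: "\<exists>!x\<in>I. ?path x \<omega>" if "\<omega> \<in> space M" "X n \<omega> = i" for \<omega>
  proof (rule ex1I[of _ "restrict (\<lambda>k. X k \<omega>) {..n}"])
    fix x assume "x \<in> I \<and> ?path x \<omega>"
    then show "x = restrict (\<lambda>k. X k \<omega>) {..n}"
      by (auto simp: I_def PiE_def extensional_def restrict_def fun_eq_iff)
  qed (use that XS in \<open>auto simp: I_def\<close>)
  have I_last: "x n = i" if "x \<in> I" for x
    using that by (simp add: I_def)
  have step: "\<P>(\<omega> in M. ?path x \<omega> \<and> X (Suc n) \<omega> = j) = \<P>(\<omega> in M. ?path x \<omega>) * P $$ (i, j)"
    if x: "x \<in> I" for x
  proof (cases "\<P>(\<omega> in M. ?path x \<omega>) > 0")
    case True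
    have x': "\<forall>k\<le>n. x k \<in> S" "x n = i"
      using x by (auto simp: I_def)
    have "\<forall>n x. \<forall>j\<in>S. (\<forall>k\<le>n. x k \<in> S) \<longrightarrow> \<P>(\<omega> in M. \<forall>k\<le>n. X k \<omega> = x k) > 0 \<longrightarrow>
        \<P>(\<omega> in M. X (Suc n) \<omega> = j \<bar> (\<forall>k\<le>n. X k \<omega> = x k)) = P $$ (x n, j)"
      using mc unfolding markov_chain_def by (rule conjunct2)
    from this[rule_format, OF j, of n x] have "\<P>(\<omega> in M. X (Suc n) \<omega> = j \<bar> ?path x \<omega>) = P $$ (i, j)"
      using x' True by simp
    with True show ?thesis
      by (simp add: cond_prob_def field_simps conj_commute)
  next
    case False
    then have "\<P>(\<omega> in M. ?path x \<omega>) = 0"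
      by (simp add: zero_less_measure_iff)
    moreover have "\<P>(\<omega> in M. ?path x \<omega> \<and> X (Suc n) \<omega> = j) \<le> \<P>(\<omega> in M. ?path x \<omega>)"
      by (intro finite_measure_mono path) auto
    ultimately show ?thesis
      using measure_nonneg[of M "{\<omega> \<in> space M. ?path x \<omega> \<and> X (Suc n) \<omega> = j}"] by simp
  qed
  have "\<P>(\<omega> in M. X n \<omega> = i \<and> X (Suc n) \<omega> = j) =
      (\<Sum>x\<in>I. \<P>(\<omega> in M. ?path x \<omega> \<and> X (Suc n) \<omega> = j))"
  proof (rule prob_sum[OF I path2])
    show "{\<omega> \<in> space M. X n \<omega> = i \<and> X (Suc n) \<omega> = j} \<in> sets M"
      by (intro sets.sets_Collect_conj ev)
    show "AE \<omega> in M. (\<forall>x\<in>I. ?path x \<omega> \<and> X (Suc n) \<omega> = j \<longrightarrow> X n \<omega> = i \<and> X (Suc n) \<omega> = j) \<and>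
        (X n \<omega> = i \<and> X (Suc n) \<omega> = j \<longrightarrow> (\<exists>!x\<in>I. ?path x \<omega> \<and> X (Suc n) \<omega> = j))"
      by (intro AE_I2 conjI ballI impI) (simp_all add: ex1 I_last)
  qed
  also have "\<dots> = (\<Sum>x\<in>I. \<P>(\<omega> in M. ?path x \<omega>)) * P $$ (i, j)"
    by (simp add: step sum_distrib_right)
  also have "(\<Sum>x\<in>I. \<P>(\<omega> in M. ?path x \<omega>)) = \<P>(\<omega> in M. X n \<omega> = i)"
  proof (rule prob_sum[OF I path, symmetric])
    show "AE \<omega> in M. (\<forall>x\<in>I. ?path x \<omega> \<longrightarrow> X n \<omega> = i) \<and> (X n \<omega> = i \<longrightarrow> (\<exists>!x\<in>I. ?path x \<omega>))"
      by (intro AE_I2 conjI ballI impI) (simp_all add: ex1 I_last)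
  qed (rule ev)
  finally show ?thesis .
qed

lemma markov_chain_law_Suc:
  assumes "prob_space M" and mc: "markov_chain M S P X" and S: "finite S" and j: "j \<in> S"
  shows "\<P>(\<omega> in M. X (Suc n) \<omega> = j) = (\<Sum>i\<in>S. \<P>(\<omega> in M. X n \<omega> = i) * P $$ (i, j))"
proof -
  interpret prob_space M by fact
  have "\<P>(\<omega> in M. X (Suc n) \<omega> = j) = (\<Sum>i\<in>S. \<P>(\<omega> in M. X n \<omega> = i \<and> X (Suc n) \<omega> = j))"
    by (rule prob_sum[OF S])
       (auto intro!: sets.sets_Collect_conj markov_chain_events[OF mc] AE_I2
         markov_chain_in_states[OF mc])
  then show ?thesis
    using assms by (simp add: markov_chain_joint_prob)
qed

text \<open>Up to null sets the events \<open>X n = s\<close> increase with \<open>n\<close>, so a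
  first visit at time \<open>n + 1\<close> means being in \<open>s\<close> then but not one step
  before.\<close>

lemma markov_chain_absorption_time:
  assumes "prob_space M" and mc: "markov_chain M S P X" and S: "finite S"
    and s: "s \<in> S" "P $$ (s, s) = 1"
  shows "\<P>(\<omega> in M. hitting_time X s \<omega> = enat (Suc n)) =
    \<P>(\<omega> in M. X (Suc n) \<omega> = s) - \<P>(\<omega> in M. X n \<omega> = s)"
proof -
  interpret prob_space M by fact
  note [measurable] = markov_chain_events[OF mc]
  \<comment> \<open>The kernel makes leaving \<open>s\<close> a null event, not an impossible one;
    countably many such events are discarded together below.\<close>
  have stay: "AE \<omega> in M. X k \<omega> = s \<longrightarrow> X (Suc k) \<omega> = s" for k
  proof -
    have "{\<omega> \<in> space M. X k \<omega> = s \<and> X (Suc k) \<omega> \<noteq> s} =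
        {\<omega> \<in> space M. X k \<omega> = s} - {\<omega> \<in> space M. X k \<omega> = s \<and> X (Suc k) \<omega> = s}"
      by auto
    then have "\<P>(\<omega> in M. X k \<omega> = s \<and> X (Suc k) \<omega> \<noteq> s) =
        \<P>(\<omega> in M. X k \<omega> = s) - \<P>(\<omega> in M. X k \<omega> = s \<and> X (Suc k) \<omega> = s)"
      by (simp only:) (subst finite_measure_Diff, auto)
    also have "\<dots> = 0"
      using markov_chain_joint_prob[OF assms(1) mc S s(1) s(1), of k] s(2) by simp
    finally have "AE \<omega> in M. \<not> (X k \<omega> = s \<and> X (Suc k) \<omega> \<noteq> s)"
      by (subst (asm) prob_eq_0) (auto elim: eventually_mono)
    then show ?thesis
      by (auto elim: eventually_mono)
  qed
  have "\<P>(\<omega> in M. hitting_time X s \<omega> = enat (Suc n)) =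
      \<P>(\<omega> in M. X (Suc n) \<omega> = s \<and> X n \<omega> \<noteq> s)"
  proof (rule prob_eq_AE)
    have "AE \<omega> in M. \<forall>k. X k \<omega> = s \<longrightarrow> X (Suc k) \<omega> = s"
      by (simp add: AE_all_countable stay)
    then show "AE \<omega> in M. hitting_time X s \<omega> = enat (Suc n) \<longleftrightarrow> X (Suc n) \<omega> = s \<and> X n \<omega> \<noteq> s"
    proof eventually_elim
      case (elim \<omega>)
      have "X n \<omega> = s" if "k \<le> n" "X k \<omega> = s" for k
        using that by (induction rule: dec_induct) (auto simp: elim)
      then show ?case
        unfolding hitting_time_eq_enat_iff by (auto simp: less_Suc_eq_le)
    qed
  qed (simp_all add: hitting_time_eq_enat_iff)
  also have "{\<omega> \<in> space M. X (Suc n) \<omega> = s \<and> X n \<omega> \<noteq> s} =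
      {\<omega> \<in> space M. X (Suc n) \<omega> = s} - {\<omega> \<in> space M. X n \<omega> = s \<and> X (Suc n) \<omega> = s}"
    by auto
  also have "prob \<dots> = \<P>(\<omega> in M. X (Suc n) \<omega> = s)
      - \<P>(\<omega> in M. X n \<omega> = s \<and> X (Suc n) \<omega> = s)"
    by (subst finite_measure_Diff) auto
  also have "\<P>(\<omega> in M. X n \<omega> = s \<and> X (Suc n) \<omega> = s) = \<P>(\<omega> in M. X n \<omega> = s)"
    using markov_chain_joint_prob[OF assms(1) mc S s(1) s(1), of n] s(2) by simp
  finally show ?thesis .
qed

section \<open>Characteristic polynomials of the leading blocks\<close>

locale absorbing_bd_chain =
  fixes d :: nat and q r p :: "nat \<Rightarrow> real"
  assumes d_pos: "0 < d"
    and sum_eq_1: "\<And>i. i \<le> d \<Longrightarrow> q i + r i + p i = 1"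
    and q_0: "q 0 = 0" and q_d: "q d = 0" and p_d: "p d = 0"
    and p_pos: "\<And>i. i < d \<Longrightarrow> 0 < p i"
    and q_pos: "\<And>i. 0 < i \<Longrightarrow> i < d \<Longrightarrow> 0 < q i"
begin

lemma r_d: "r d = 1"
  using sum_eq_1[of d] q_d p_d by simp

text \<open>This is the \<open>D\<^sub>k\<close> of the overview, introduced by its three-term
  recurrence so that inductions follow it directly.\<close>

fun block_poly :: "nat \<Rightarrow> complex poly" where
  "block_poly 0 = 1"
| "block_poly (Suc 0) = [:- of_real (r 0), 1:]"
| "block_poly (Suc (Suc k)) = [:- of_real (r (Suc k)), 1:] * block_poly (Suc k)
     - [:of_real (p k * q (Suc k)):] * block_poly k"

lemma block_poly_eq_det:
  "block_poly k = Determinant.det (tridiag_mat k (\<lambda>i. [:- of_real (q i):])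
     (\<lambda>i. [:- of_real (r i), 1:]) (\<lambda>i. [:- of_real (p i):]))"
proof (induction k rule: block_poly.induct)
  case 2
  show ?case
    by (subst det_single) (auto simp: tridiag_mat_def)
next
  case (3 k)
  then show ?case
    by (simp add: det_tridiag_mat_Suc_Suc algebra_simps)
qed simp

text \<open>The whole kernel is the block of size \<open>d + 1\<close>. In the last step of its
  recurrence \<open>q d = 0\<close> kills the second term and \<open>r d = 1\<close> leaves the
  factor \<open>x - 1\<close>.\<close>

lemma char_poly_bd_kernel:
  "char_poly (map_mat complex_of_real (bd_kernel d q r p)) = [:-1, 1:] * block_poly d"
proof -
  have "char_poly_matrix (map_mat complex_of_real (bd_kernel d q r p)) =
      tridiag_mat (Suc d) (\<lambda>i. [:- of_real (q i):])
        (\<lambda>i. [:- of_real (r i), 1:]) (\<lambda>i. [:- of_real (p i):])"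
    by (rule eq_matI) (auto simp: char_poly_matrix_def bd_kernel_def tridiag_mat_def)
  then have "char_poly (map_mat complex_of_real (bd_kernel d q r p)) = block_poly (Suc d)"
    by (simp add: char_poly_def block_poly_eq_det)
  also have "\<dots> = [:-1, 1:] * block_poly d"
    using d_pos q_d r_d by (cases d) auto
  finally show ?thesis .
qed

text \<open>Ensures that \<open>block_poly d\<close> has exactly \<open>d\<close> roots and is the
  product of its linear factors with no constant in front.\<close>

lemma block_poly_monic: "degree (block_poly k) = k \<and> lead_coeff (block_poly k) = 1"
proof (induction k rule: block_poly.induct)
  case (3 k)
  let ?A = "[:- of_real (r (Suc k)), 1:] * block_poly (Suc k)"
  let ?B = "[:- complex_of_real (p k * q (Suc k)):] * block_poly k"
  have nz: "block_poly (Suc k) \<noteq> 0"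
    using 3 by (metis degree_0 nat.distinct(1))
  have degA: "degree ?A = Suc (Suc k)"
    using 3 nz by (subst degree_mult_eq) auto
  have lcA: "lead_coeff ?A = 1"
    unfolding lead_coeff_mult using 3 by (metis lead_coeff_pCons(1) lead_coeff_1 mult_1 one_neq_zero one_pCons pCons_eq_0_iff)
  have "degree ?B < degree ?A"
    using 3 degA by (auto simp: degree_smult_eq)
  then have "degree (?A + ?B) = degree ?A" "lead_coeff (?A + ?B) = lead_coeff ?A"
    by (simp_all only: degree_add_eq_left coeff_add coeff_eq_0 add_0_right)
  moreover have "block_poly (Suc (Suc k)) = ?A + ?B"
    by simp
  ultimately show ?case
    using degA lcA by metis
qed auto

text \<open>At 1 the diagonal factor is \<open>q + p\<close>; by induction its \<open>q\<close> part
  cancels against the second term of the recurrence.\<close>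

lemma poly_block_poly_1: "k \<le> d \<Longrightarrow> poly (block_poly k) 1 = (\<Prod>i<k. of_real (p i))"
proof (induction k rule: block_poly.induct)
  case 2
  then show ?case
    using sum_eq_1[of 0] q_0 by (simp add: algebra_simps flip: of_real_add)
next
  case (3 k)
  have r: "r (Suc k) = 1 - q (Suc k) - p (Suc k)"
    using sum_eq_1[of "Suc k"] 3 by simp
  show ?case
    using 3 by (simp add: r algebra_simps)
qed simp

lemma prod_p_nonzero: "k \<le> d \<Longrightarrow> (\<Prod>i<k. complex_of_real (p i)) \<noteq> 0"
  using p_pos by (metis (no_types, lifting) finite_lessThan lessThan_iff less_irrefl
      of_real_eq_0_iff order_less_le_trans prod_zero_iff)

section \<open>Eigenfunctions and reality of the eigenvalues\<close>

text \<open>The \<open>\<phi>\<close> of the overview, for arbitrary complex \<open>x\<close>.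
  Vanishing at \<open>d\<close> is what singles out the eigenvalues of the block below
  \<open>d\<close>.\<close>

definition eigenfun :: "complex \<Rightarrow> nat \<Rightarrow> complex" where
  "eigenfun x k = poly (block_poly k) x / (\<Prod>i<k. of_real (p i))"

lemma eigenfun_0 [simp]: "eigenfun x 0 = 1"
  by (simp add: eigenfun_def)

lemma eigenfun_d_eq_0_iff: "eigenfun x d = 0 \<longleftrightarrow> poly (block_poly d) x = 0"
  using prod_p_nonzero[of d] by (simp add: eigenfun_def)

text \<open>The recurrence of \<open>block_poly\<close> divided by the product of birth
  probabilities. At \<open>i = 0\<close> truncated subtraction gives \<open>i - 1 = 0\<close>, which
  is harmless because \<open>q 0 = 0\<close>.\<close>

lemma eigenfun_rec:
  assumes "i < d"
  shows "of_real (q i) * eigenfun x (i - 1) + of_real (r i) * eigenfun x i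
    + of_real (p i) * eigenfun x (Suc i) = x * eigenfun x i"
proof (cases i)
  case 0
  then show ?thesis
    using assms q_0 p_pos[of 0] by (simp add: eigenfun_def)
next
  case (Suc k)
  define P where "P = (\<Prod>i<k. complex_of_real (p i))"
  have "P \<noteq> 0" "p k \<noteq> 0" "p (Suc k) \<noteq> 0"
    using assms Suc prod_p_nonzero[of k] p_pos[of k] p_pos[of "Suc k"] by (auto simp: P_def)
  then show ?thesis
    by (simp add: eigenfun_def Suc flip: P_def) (simp add: field_simps)
qed

text \<open>Let \<open>\<pi>\<close> be the reversing weights. The Casoratian \<open>\<pi> k * p k * Im (\<phi> (k + 1) * cnj (\<phi> k))\<close>
  equals \<open>Im x\<close> times a positive sum, and it vanishes at \<open>k = d - 1\<close> because \<open>\<phi> d = 0\<close>.\<close>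

lemma block_poly_root_real:
  assumes "poly (block_poly d) x = 0"
  shows "Im x = 0"
proof -
  define \<phi> where "\<phi> = eigenfun x"
  define \<pi> where "\<pi> k = (\<Prod>i<k. p i / q (Suc i))" for k
  have \<pi>_pos: "0 < \<pi> k" if "k < d" for k
    unfolding \<pi>_def using that by (intro prod_pos) (auto intro!: divide_pos_pos p_pos q_pos)
  \<comment> \<open>Multiply the eigenvalue equation by \<open>cnj (\<phi> i)\<close> and take
    imaginary parts; the term with \<open>r i\<close> is real and drops out.\<close>
  have rec: "p i * Im (\<phi> (Suc i) * cnj (\<phi> i)) =
      Im x * (cmod (\<phi> i))\<^sup>2 + q i * Im (\<phi> i * cnj (\<phi> (i - 1)))" if "i < d" for i
  proof -
    have "of_real (p i) * \<phi> (Suc i) = x * \<phi> i - of_real (q i) * \<phi> (i - 1) - of_real (r i) * \<phi> i"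
      using eigenfun_rec[OF that, of x] by (simp add: \<phi>_def algebra_simps)
    then have "Im (of_real (p i) * \<phi> (Suc i) * cnj (\<phi> i)) =
      Im ((x * \<phi> i - of_real (q i) * \<phi> (i - 1) - of_real (r i) * \<phi> i) * cnj (\<phi> i))"
      by simp
    then show ?thesis
      by (simp add: cmod_power2) (simp add: algebra_simps power2_eq_square)
  qed
  have acc: "\<pi> k * p k * Im (\<phi> (Suc k) * cnj (\<phi> k)) =
      Im x * (\<Sum>i\<le>k. \<pi> i * (cmod (\<phi> i))\<^sup>2)" if "k < d" for k
    using that
  proof (induction k)
    case 0
    then show ?case
      using rec[of 0] q_0 by (simp add: \<pi>_def)
  next
    case (Suc k)
    \<comment> \<open>Detailed balance turns the \<open>q\<close> term of \<open>rec\<close> into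
      the preceding Casoratian.\<close>
    have "\<pi> (Suc k) * q (Suc k) = \<pi> k * p k"
      using q_pos[of "Suc k"] Suc.prems by (simp add: \<pi>_def)
    then have "\<pi> (Suc k) * p (Suc k) * Im (\<phi> (Suc (Suc k)) * cnj (\<phi> (Suc k))) =
        \<pi> (Suc k) * (Im x * (cmod (\<phi> (Suc k)))\<^sup>2) + \<pi> k * p k * Im (\<phi> (Suc k) * cnj (\<phi> k))"
      unfolding mult.assoc rec[OF Suc.prems] by (simp add: distrib_left flip: mult.assoc)
    with Suc show ?case
      by (simp add: algebra_simps)
  qed
  have "\<phi> d = 0"
    using assms by (simp add: \<phi>_def eigenfun_d_eq_0_iff)
  then have "Im x * (\<Sum>i\<le>d - 1. \<pi> i * (cmod (\<phi> i))\<^sup>2) = 0"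
    using acc[of "d - 1"] d_pos by simp
  \<comment> \<open>Strict positivity comes from the term at 0, where
    \<open>\<phi> 0 = 1\<close>.\<close>
  moreover have "0 < (\<Sum>i\<le>d - 1. \<pi> i * (cmod (\<phi> i))\<^sup>2)"
  proof (rule sum_pos2[of _ 0])
    show "0 < \<pi> 0 * (cmod (\<phi> 0))\<^sup>2"
      by (simp add: \<pi>_def \<phi>_def)
    show "0 \<le> \<pi> i * (cmod (\<phi> i))\<^sup>2" if "i \<in> {..d - 1}" for i
    proof -
      have "i < d"
        using that d_pos by auto
      then show ?thesis
        using \<pi>_pos[of i] by simp
    qed
  qed auto
  ultimately show ?thesis
    by simp
qed

section \<open>Mean time to absorption\<close>

text \<open>\<open>mean_passage_time i\<close> is the mean time to go from \<open>i\<close> to \<open>i + 1\<close>.\<close>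

fun mean_passage_time :: "nat \<Rightarrow> real" where
  "mean_passage_time 0 = 1 / p 0"
| "mean_passage_time (Suc i) = (q (Suc i) * mean_passage_time i + 1) / p (Suc i)"

lemma mean_passage_time_pos: "i < d \<Longrightarrow> 0 < mean_passage_time i"
proof (induction i)
  case (Suc i)
  then have "0 < q (Suc i) * mean_passage_time i"
    by (intro mult_pos_pos q_pos) auto
  with Suc.prems show ?case
    by (simp add: p_pos)
qed (simp add: p_pos)

definition mean_hitting_time :: "nat \<Rightarrow> real" where
  "mean_hitting_time i = (\<Sum>k\<in>{i..<d}. mean_passage_time k)"

lemma mean_hitting_time_d [simp]: "mean_hitting_time d = 0"
  by (simp add: mean_hitting_time_def)

lemma mean_hitting_time_nonneg: "0 \<le> mean_hitting_time i"
  unfolding mean_hitting_time_def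
  by (intro sum_nonneg) (auto intro: less_imp_le mean_passage_time_pos)

text \<open>First-step analysis, the equation \<open>P h = h - 1\<close>. Consecutive values of
  \<open>h\<close> differ by a mean passage time, which reduces it to the recursion of those
  times.\<close>

lemma mean_hitting_time_rec:
  assumes "i < d"
  shows "q i * mean_hitting_time (i - 1) + r i * mean_hitting_time i
    + p i * mean_hitting_time (Suc i) = mean_hitting_time i - 1"
proof -
  have 1: "mean_hitting_time k = mean_passage_time k + mean_hitting_time (Suc k)" if "k < d" for k
    using that by (simp add: mean_hitting_time_def sum.atLeast_Suc_lessThan)
  have r: "r i = 1 - q i - p i"
    using sum_eq_1[of i] assms by simp
  have "p i * mean_passage_time i = q i * mean_passage_time (i - 1) + 1"
    using p_pos[of i] assms q_0 by (cases i) auto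
  moreover have "q i * mean_hitting_time (i - 1) =
      q i * mean_passage_time (i - 1) + q i * mean_hitting_time i"
    using 1[of "i - 1"] assms q_0 by (cases i) (auto simp: algebra_simps)
  ultimately show ?thesis
    unfolding r 1[OF assms] by (simp add: algebra_simps)
qed

end

section \<open>Evolution of the law and decay of the transient mass\<close>

text \<open>\<open>a n i\<close> is the probability of being in state \<open>i\<close> at time \<open>n\<close>.\<close>

locale absorbing_bd_law = absorbing_bd_chain +
  fixes a :: "nat \<Rightarrow> nat \<Rightarrow> real"
  assumes a_nonneg: "\<And>n i. 0 \<le> a n i"
    and a_0: "\<And>i. i \<le> d \<Longrightarrow> a 0 i = (if i = 0 then 1 else 0)"
    and a_Suc: "\<And>n j. j \<le> d \<Longrightarrow> a (Suc n) j = (\<Sum>i\<le>d. a n i * bd_kernel d q r p $$ (i, j))"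
begin

text \<open>Both ends fit the general formula: \<open>q 0 = 0\<close> removes the spurious neighbour
  of 0, and \<open>p d = 0\<close> the one of \<open>d\<close>.\<close>

lemma sum_bd_kernel:
  fixes f :: "nat \<Rightarrow> 'a::{real_algebra_1,comm_ring_1}"
  assumes "i \<le> d"
  shows "(\<Sum>j\<le>d. of_real (bd_kernel d q r p $$ (i, j)) * f j) =
    of_real (q i) * f (i - 1) + of_real (r i) * f i + of_real (p i) * f (Suc i)"
proof -
  have "(\<Sum>j\<le>d. of_real (bd_kernel d q r p $$ (i, j)) * f j) =
    (\<Sum>j\<le>d. (if j = i - 1 then of_real (q i) * f (i - 1) else 0)
      + (if j = i then of_real (r i) * f i else 0)
      + (if j = Suc i then of_real (p i) * f (Suc i) else 0))"
    using assms q_0 by (intro sum.cong) (auto simp: bd_kernel_def)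
  also have "\<dots> = of_real (q i) * f (i - 1) + of_real (r i) * f i + of_real (p i) * f (Suc i)"
    using assms p_d by (cases "i = d") (auto simp: sum.distrib)
  finally show ?thesis .
qed

text \<open>Mass in \<open>d\<close> stays there, so cancelling it leaves only the newly absorbed
  mass \<open>a (Suc n) d - a n d\<close>. The type is general to cover the real mean hitting time
  and the complex eigenfunction.\<close>

lemma expectation_Suc:
  fixes f :: "nat \<Rightarrow> 'a::{real_algebra_1,comm_ring_1}"
  assumes f: "\<And>i. i < d \<Longrightarrow>
    of_real (q i) * f (i - 1) + of_real (r i) * f i + of_real (p i) * f (Suc i) = g i"
  shows "(\<Sum>i<d. of_real (a (Suc n) i) * f i) + of_real (a (Suc n) d - a n d) * f d =
    (\<Sum>i<d. of_real (a n i) * g i)"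
proof -
  have "(\<Sum>j\<le>d. of_real (a (Suc n) j) * f j) =
      (\<Sum>j\<le>d. \<Sum>i\<le>d. of_real (a n i) * (of_real (bd_kernel d q r p $$ (i, j)) * f j))"
    by (intro sum.cong) (simp_all add: a_Suc sum_distrib_right mult.assoc)
  also have "\<dots> = (\<Sum>i\<le>d. of_real (a n i) * (\<Sum>j\<le>d. of_real (bd_kernel d q r p $$ (i, j)) * f j))"
    by (subst sum.swap) (simp add: sum_distrib_left)
  also have "\<dots> = (\<Sum>i\<le>d. of_real (a n i) *
      (of_real (q i) * f (i - 1) + of_real (r i) * f i + of_real (p i) * f (Suc i)))"
    by (intro sum.cong) (simp_all add: sum_bd_kernel)
  also have "\<dots> = (\<Sum>i<d. of_real (a n i) * g i) + of_real (a n d) * f d"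
    by (simp add: f q_d r_d p_d del: One_nat_def flip: lessThan_Suc_atMost)
  finally show ?thesis
    by (simp add: algebra_simps flip: lessThan_Suc_atMost)
qed

text \<open>The mean remaining time to absorption decreases at step \<open>n\<close> by exactly the
  probability of not yet being absorbed, which is therefore summable.\<close>

lemma law_tendsto_0:
  assumes "i < d"
  shows "(\<lambda>n. a n i) \<longlonglongrightarrow> 0"
proof -
  define W where "W n = (\<Sum>i<d. a n i * mean_hitting_time i)" for n
  have W_nonneg: "0 \<le> W n" for n
    unfolding W_def by (intro sum_nonneg mult_nonneg_nonneg a_nonneg mean_hitting_time_nonneg)
  \<comment> \<open>The value 0 of \<open>mean_hitting_time\<close> at \<open>d\<close> removes the
    absorbed mass from the one-step identity.\<close>
  have W_Suc: "W (Suc n) = W n - (\<Sum>i<d. a n i)" for n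
    using expectation_Suc[of mean_hitting_time "\<lambda>i. mean_hitting_time i - 1" n] mean_hitting_time_rec
    by (simp add: W_def right_diff_distrib sum_subtractf)
  have S_nonneg: "0 \<le> (\<Sum>i<d. a n i)" for n
    by (intro sum_nonneg a_nonneg)
  have "decseq W"
    by (rule decseq_SucI) (use W_Suc S_nonneg in simp)
  then obtain L where L: "W \<longlonglongrightarrow> L"
    using decseq_convergent[of W 0] W_nonneg by blast
  have "(\<lambda>n. W n - W (Suc n)) \<longlonglongrightarrow> L - L"
    by (intro tendsto_diff L LIMSEQ_Suc)
  then have lim: "(\<lambda>n. \<Sum>i<d. a n i) \<longlonglongrightarrow> 0"
    by (simp add: W_Suc)
  show ?thesis
  proof (rule tendsto_sandwich[OF _ _ tendsto_const lim])
    show "\<forall>\<^sub>F n in sequentially. 0 \<le> a n i"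
      by (simp add: a_nonneg)
    show "\<forall>\<^sub>F n in sequentially. a n i \<le> (\<Sum>i<d. a n i)"
      using assms by (intro always_eventually allI member_le_sum) (auto simp: a_nonneg)
  qed
qed

text \<open>The mean of the eigenfunction at time \<open>n\<close> on the event that absorption has not yet occurred.\<close>

definition transient_mean :: "complex \<Rightarrow> nat \<Rightarrow> complex" where
  "transient_mean x n = (\<Sum>i<d. of_real (a n i) * eigenfun x i)"

lemma transient_mean_0: "transient_mean x 0 = 1"
proof -
  have "transient_mean x 0 = (\<Sum>i<d. if i = 0 then 1 else 0)"
    unfolding transient_mean_def by (intro sum.cong) (auto simp: a_0)
  then show ?thesis
    using d_pos by simp
qed

lemma transient_mean_tendsto_0: "transient_mean x \<longlonglongrightarrow> 0"
proof -
  have "(\<lambda>n. \<Sum>i<d. of_real (a n i) * eigenfun x i) \<longlonglongrightarrow> (\<Sum>i<d. of_real 0 * eigenfun x i)"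
    by (intro tendsto_intros law_tendsto_0) auto
  then show ?thesis
    by (simp add: transient_mean_def[abs_def])
qed

lemma transient_mean_Suc:
  "transient_mean x (Suc n) + of_real (a (Suc n) d - a n d) * eigenfun x d = x * transient_mean x n"
  using expectation_Suc[of "eigenfun x" "\<lambda>i. x * eigenfun x i" n, OF eigenfun_rec]
  by (simp add: transient_mean_def sum_distrib_left mult.left_commute)

text \<open>At a root the absorbed mass carries weight 0, so the transient mean is exactly
  \<open>x ^ n\<close>, and it tends to 0.\<close>

lemma block_poly_root_norm_less_1:
  assumes "poly (block_poly d) x = 0"
  shows "norm x < 1"
proof (rule ccontr)
  assume "\<not> norm x < 1"
  have "eigenfun x d = 0"
    using assms by (simp add: eigenfun_d_eq_0_iff)
  then have "transient_mean x n = x ^ n" for n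
    using transient_mean_Suc[of x] by (induction n) (auto simp: transient_mean_0)
  then have "(\<lambda>n. norm (x ^ n)) \<longlonglongrightarrow> 0"
    using tendsto_norm[OF transient_mean_tendsto_0[of x]] by simp
  then have "eventually (\<lambda>n. norm (x ^ n) < 1) sequentially"
    by (rule order_tendstoD) simp
  then obtain n where "norm (x ^ n) < 1"
    by (auto simp: eventually_sequentially)
  with \<open>\<not> norm x < 1\<close> show False
    by (simp add: norm_power) (meson leD not_le one_le_power)
qed

text \<open>With \<open>x = 1 / u\<close>, multiplying the one-step identity by
  \<open>u ^ Suc n\<close> makes it telescope. The remainder vanishes because the transient mean
  does and the powers of \<open>u\<close> stay bounded.\<close>

lemma absorption_pgf_sums:
  fixes u :: complex
  assumes u: "norm u \<le> 1" "u \<noteq> 0"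
  shows "(\<lambda>n. of_real (a (Suc n) d - a n d) * u ^ Suc n * eigenfun (1 / u) d) sums 1"
proof -
  let ?x = "1 / u"
  have "(\<Sum>n<N. of_real (a (Suc n) d - a n d) * u ^ Suc n * eigenfun ?x d) =
      1 - u ^ N * transient_mean ?x N" for N
  proof (induction N)
    case (Suc N)
    have "of_real (a (Suc N) d - a N d) * eigenfun ?x d = ?x * transient_mean ?x N - transient_mean ?x (Suc N)"
      using transient_mean_Suc[of ?x N] by (simp add: algebra_simps)
    then have "of_real (a (Suc N) d - a N d) * u ^ Suc N * eigenfun ?x d =
        u ^ Suc N * (?x * transient_mean ?x N - transient_mean ?x (Suc N))"
      by (metis mult.commute mult.left_commute)
    then show ?case
      using Suc u(2) by (simp add: right_diff_distrib)
  qed (simp add: transient_mean_0)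
  moreover have "(\<lambda>N. u ^ N * transient_mean ?x N) \<longlonglongrightarrow> 0"
  proof (rule Lim_null_comparison)
    show "\<forall>\<^sub>F N in sequentially. norm (u ^ N * transient_mean ?x N) \<le> norm (transient_mean ?x N)"
      using u(1) by (intro always_eventually) (auto simp: norm_mult norm_power intro!: mult_left_le_one_le power_le_one)
    show "(\<lambda>N. norm (transient_mean ?x N)) \<longlonglongrightarrow> 0"
      using tendsto_norm[OF transient_mean_tendsto_0] by simp
  qed
  then have "(\<lambda>N. 1 - u ^ N * transient_mean ?x N) \<longlonglongrightarrow> 1 - 0"
    by (intro tendsto_intros)
  ultimately show ?thesis
    by (simp add: sums_def)
qed

end

section \<open>Spectrum and generating function of the absorption time\<close>

theorem theorem1p2:
  fixes d :: nat and p q r :: "nat \<Rightarrow> real"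
    and M :: "'w measure" and X :: "nat \<Rightarrow> 'w \<Rightarrow> nat"
  assumes "d \<ge> 1"
    and "bd_probs d q r p"
    and "bd_kernel d q r p $$ (d, d) = 1"
    and "\<And>i. i \<le> d - 1 \<Longrightarrow> 0 < p i"
    and "\<And>i. 1 \<le> i \<Longrightarrow> i \<le> d - 1 \<Longrightarrow> 0 < q i"
    and "prob_space M"
    and "markov_chain M {0..d} (bd_kernel d q r p) X"
    and "AE \<omega> in M. X 0 \<omega> = 0"
  shows "\<exists>\<theta> :: nat \<Rightarrow> real.
      {#x \<in># eigenvalues_mset (bd_kernel d q r p). x \<noteq> 1#}
        = image_mset (\<lambda>j. complex_of_real (\<theta> j)) (mset_set {0..d - 1}) \<and>
      (\<forall>j \<le> d - 1. - 1 \<le> \<theta> j \<and> \<theta> j < 1) \<and>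
      (\<forall>u :: complex. norm u \<le> 1 \<longrightarrow>
         pgf M (hitting_time X d) u
           = (\<Prod>j = 0..d - 1. (1 - of_real (\<theta> j)) * u / (1 - of_real (\<theta> j) * u)))"
proof -
  interpret prob_space M by fact
  note mc = assms(7) and bd = assms(2)[unfolded bd_probs_def]
  let ?K = "bd_kernel d q r p" and ?T = "hitting_time X d"
  have rd: "r d = 1"
    using assms(3) by (simp add: bd_kernel_def)
  have "0 \<le> q d" "0 \<le> p d" "q d + r d + p d = 1"
    using bd by blast+
  then have qd: "q d = 0"
    using rd by simp
  interpret absorbing_bd_chain d q r p
    by unfold_locales (use assms(1,4,5) bd qd in auto)
  interpret absorbing_bd_law d q r p "\<lambda>n i. \<P>(\<omega> in M. X n \<omega> = i)"
  proof
    fix n j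
    show "\<P>(\<omega> in M. X 0 \<omega> = j) = (if j = 0 then 1 else 0)"
    proof (cases "j = 0")
      case True
      then show ?thesis
        using assms(8) by (simp add: prob_eq_1 markov_chain_events[OF mc])
    next
      case False
      have "AE \<omega> in M. X 0 \<omega> \<noteq> j"
        using assms(8) by eventually_elim (use False in simp)
      then show ?thesis
        using False by (simp add: prob_eq_0 markov_chain_events[OF mc])
    qed
    show "\<P>(\<omega> in M. X (Suc n) \<omega> = j) = (\<Sum>i\<le>d. \<P>(\<omega> in M. X n \<omega> = i) * ?K $$ (i, j))" if "j \<le> d"
      using markov_chain_law_Suc[OF \<open>prob_space M\<close> mc, of j n] that
      by (simp add: atLeast0AtMost)
  qed auto
  \<comment> \<open>The start at 0 and \<open>d > 0\<close> rule out immediate absorption; this lets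
    the series be shifted to start at time 1.\<close>
  have T_0: "\<P>(\<omega> in M. ?T \<omega> = enat 0) = 0"
    using a_0[of d] d_pos by (simp add: hitting_time_eq_enat_iff)
  have T_Suc: "\<P>(\<omega> in M. ?T \<omega> = enat (Suc n)) = \<P>(\<omega> in M. X (Suc n) \<omega> = d) - \<P>(\<omega> in M. X n \<omega> = d)" for n
    by (rule markov_chain_absorption_time[OF \<open>prob_space M\<close> mc]) (use assms(3) in auto)
  have "{\<omega> \<in> space M. ?T \<omega> = enat n} \<in> sets M" for n
    unfolding hitting_time_eq_enat_iff using markov_chain_events[OF mc] by measurable
  note pgf = prob_space_pgf_sums[OF \<open>prob_space M\<close> this]

  \<comment> \<open>Listing the roots with multiplicity gives the indexing of
    \<open>\<theta>\<close>; taking real parts loses nothing since the roots are real.\<close>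
  obtain xs where xs: "mset xs = proots (block_poly d)"
    using ex_mset by blast
  have len: "length xs = d"
    using xs size_proots_complex[of "block_poly d"] block_poly_monic[of d] by (metis size_mset)
  define \<theta> where "\<theta> j = Re (xs ! j)" for j
  have nz: "block_poly d \<noteq> 0"
    using block_poly_monic[of d] by auto
  have root: "poly (block_poly d) (xs ! j) = 0" if "j < d" for j
  proof -
    have "xs ! j \<in># proots (block_poly d)"
      using that len by (simp flip: xs)
    then show ?thesis
      using nz by simp
  qed
  have \<theta>: "of_real (\<theta> j) = xs ! j" if "j < d" for j
    using block_poly_root_real[OF root[OF that]] by (simp add: \<theta>_def complex_eq_iff)
  have \<theta>_abs: "\<bar>\<theta> j\<bar> < 1" if "j < d" for j
    using block_poly_root_norm_less_1[OF root[OF that]] \<theta>[OF that] by (metis norm_of_real)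
  have index: "{0..d - 1} = {..<d}"
    using d_pos by auto
  have mset_\<theta>: "image_mset (\<lambda>j. complex_of_real (\<theta> j)) (mset_set {..<d}) = proots (block_poly d)"
  proof -
    have "image_mset (\<lambda>j. complex_of_real (\<theta> j)) (mset_set {..<d}) = image_mset ((!) xs) (mset_set {..<d})"
      by (intro image_mset_cong) (simp add: \<theta>)
    also have "\<dots> = mset (map ((!) xs) [0..<length xs])"
      by (simp add: len lessThan_atLeast0)
    also have "\<dots> = proots (block_poly d)"
      by (simp only: map_nth xs)
    finally show ?thesis .
  qed
  have poly_eq: "poly (block_poly d) x = (\<Prod>j<d. x - of_real (\<theta> j))" for x
  proof -
    have lc: "lead_coeff (block_poly d) = 1"
      using block_poly_monic by blast
    have "block_poly d = (\<Prod>y\<in>#proots (block_poly d). [:- y, 1:])"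
      using complex_poly_decompose_multiset[of "block_poly d"] unfolding lc by simp
    also have "\<dots> = (\<Prod>j<d. [:- of_real (\<theta> j), 1:])"
      by (simp flip: mset_\<theta> add: prod_unfold_prod_mset image_mset.compositionality comp_def)
    finally show ?thesis
      by (simp add: poly_prod)
  qed
  have "proots (char_poly (map_mat complex_of_real ?K)) = {#1#} + proots (block_poly d)"
    unfolding char_poly_bd_kernel using nz by (subst proots_mult) auto
  \<comment> \<open>The value of \<open>block_poly d\<close> at 1 is a product of positive birth
    probabilities. Hence the eigenvalue 1 is simple, and filtering it out leaves exactly the roots
    of \<open>block_poly d\<close>.\<close>
  moreover have "1 \<notin># proots (block_poly d)"
    using nz poly_block_poly_1[of d] prod_p_nonzero[of d] by auto
  ultimately have spectrum: "{#x \<in># eigenvalues_mset ?K. x \<noteq> 1#} = proots (block_poly d)"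
    by (auto simp: eigenvalues_mset_def filter_mset_eq_conv)

  have "pgf M ?T u = (\<Prod>j<d. (1 - of_real (\<theta> j)) * u / (1 - of_real (\<theta> j) * u))"
    if u: "norm u \<le> 1" for u
  \<comment> \<open>The eigenfunction is taken at \<open>1 / u\<close>, so \<open>u = 0\<close> is
    separate: both sides are then 0.\<close>
  proof (cases "u = 0")
    case True
    have "(\<lambda>n. of_real (\<P>(\<omega> in M. ?T \<omega> = enat n)) * u ^ n) = (\<lambda>_. 0)"
      using T_0 True by (auto simp: fun_eq_iff power_0_left)
    then have "pgf M ?T u = 0"
      using pgf[OF u] sums_unique2 sums_zero by metis
    with True d_pos show ?thesis
      by (auto simp: prod_zero_iff)
  next
    case False
    have ne: "1 - of_real (\<theta> j) * u \<noteq> 0" if "j < d" for j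
    proof
      assume "1 - of_real (\<theta> j) * u = 0"
      then have "norm (of_real (\<theta> j) * u) = 1"
        by simp
      moreover have "norm (of_real (\<theta> j) * u) \<le> \<bar>\<theta> j\<bar>"
        using u by (simp add: norm_mult mult_left_le)
      ultimately show False
        using \<theta>_abs[OF that] by simp
    qed
    let ?\<phi> = "eigenfun (1 / u) d"
    have "(\<lambda>n. of_real (\<P>(\<omega> in M. ?T \<omega> = enat n)) * u ^ n * ?\<phi>) sums (pgf M ?T u * ?\<phi>)"
      by (intro sums_mult2 pgf u)
    then have "(\<lambda>n. of_real (\<P>(\<omega> in M. ?T \<omega> = enat (Suc n))) * u ^ Suc n * ?\<phi>) sums (pgf M ?T u * ?\<phi>)"
      by (subst sums_Suc_iff) (simp add: T_0)
    then have "pgf M ?T u * ?\<phi> = 1"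
      using absorption_pgf_sums[OF u False] unfolding T_Suc by (rule sums_unique2)
    moreover have "(\<Prod>j<d. (1 - of_real (\<theta> j)) * u / (1 - of_real (\<theta> j) * u)) * ?\<phi> = 1"
    proof -
      \<comment> \<open>The product of birth probabilities is read as the value of
        \<open>block_poly d\<close> at 1, so numerator and denominator both factor over the
        \<open>\<theta> j\<close>.\<close>
      have "?\<phi> = (\<Prod>j<d. 1 / u - of_real (\<theta> j)) / (\<Prod>j<d. 1 - of_real (\<theta> j))"
        unfolding eigenfun_def poly_block_poly_1[of d, OF order_refl, symmetric] poly_eq ..
      also have "\<dots> = (\<Prod>j<d. (1 / u - of_real (\<theta> j)) / (1 - of_real (\<theta> j)))"
        by (simp add: prod_dividef)
      finally have "(\<Prod>j<d. (1 - of_real (\<theta> j)) * u / (1 - of_real (\<theta> j) * u)) * ?\<phi> =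
          (\<Prod>j<d. (1 - of_real (\<theta> j)) * u / (1 - of_real (\<theta> j) * u)
            * ((1 / u - of_real (\<theta> j)) / (1 - of_real (\<theta> j))))"
        by (simp only: prod.distrib)
      also have "\<dots> = 1"
      proof (intro prod.neutral ballI)
        fix j assume "j \<in> {..<d}"
        then have j: "j < d"
          by simp
        have "\<theta> j \<noteq> 1"
          using \<theta>_abs[OF j] by auto
        then have "1 - complex_of_real (\<theta> j) \<noteq> 0"
          by (metis of_real_eq_1_iff right_minus_eq)
        moreover have "1 / u - of_real (\<theta> j) = (1 - of_real (\<theta> j) * u) / u"
          using False by (simp add: diff_divide_distrib)
        ultimately show "(1 - of_real (\<theta> j)) * u / (1 - of_real (\<theta> j) * u)
            * ((1 / u - of_real (\<theta> j)) / (1 - of_real (\<theta> j))) = 1"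
          using ne[OF j] False by simp
      qed
      finally show ?thesis .
    qed
    ultimately have "pgf M ?T u * ?\<phi> = (\<Prod>j<d. (1 - of_real (\<theta> j)) * u / (1 - of_real (\<theta> j) * u)) * ?\<phi>"
      and "?\<phi> \<noteq> 0"
      by auto
    then show ?thesis
      by (rule mult_right_cancel[THEN iffD1, rotated])
  qed
  moreover have "\<forall>j\<le>d - 1. - 1 \<le> \<theta> j \<and> \<theta> j < 1"
  proof (intro allI impI)
    fix j assume "j \<le> d - 1"
    then have "j < d"
      using d_pos by simp
    then show "- 1 \<le> \<theta> j \<and> \<theta> j < 1"
      using \<theta>_abs[of j] by (simp add: abs_less_iff)
  qed
  ultimately show ?thesis
    using spectrum mset_\<theta> unfolding index by (intro exI[of _ \<theta>]) simp
qed

end
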